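(* Let $A$ be a finite-dimensional real alternative algebra with unity and a fixed antiinvolution $x\mapsto x^c$, with $\mathbb{S}_A\ne\emptyset$. Let $f=\mathcal{I}(F)$ be an admissible slice regular function on $\Omega_D$, and let $y\in V(f)$. Then the following statements hold. (1) If $y$ is a real zero, then there exists a slice regular function $g$ on $\Omega_D$ such that $f(x)=(x-y)\,g(x)$. (2) If $y\in\Omega_D\setminus\mathbb{R}$, then there exist a slice regular function $h$ on $\Omega_D$ and $a,b\in A$ such that $\langle a,b\rangle\subseteq N_A$ and $f(x)=\Delta_y(x)\,h(x)+xa+b$. Moreover: - $y$ is a spherical zero of $f$ if and only if $a=b=0$; - $y$ is an $\mathbb{S}_A$-isolated non-real zero of $f$ if and only if $a\neq0$ (in this case $y=-ba^{-1}$). If there exists a real subspace $V\subseteq N_A$ such that $F(z)\in V\otimes\mathbb{C}$ for all $z\in D$, then $g$ and $h$ are admissible. If $f$ is real, then $g,h$ are real and $a=b=0$.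
   Context: Setting. $A$ is a finite-dimensional real alternative algebra with unity, of real dimension $d>1$ (alternative: the associator $(x,y,z)=(xy)z-x(yz)$ is alternating); $\mathbb{R}$ is identified with $\mathbb{R}\cdot 1\subseteq A$. An antiinvolution $x\mapsto x^c$ is fixed: a linear map with $(x^c)^c=x$, $(xy)^c=y^cx^c$, and $x^c=x$ for $x\in\mathbb{R}$. Put $t(x)=x+x^c$, $n(x)=xx^c$ (elements of $A$, not assumed real). Normal cone: $N_A=\{0\}\cup\{x\in A \mid n(x)=n(x^c)\text{ is a real nonzero number}\}$ (its nonzero elements are invertible). Quadratic cone: $Q_A=\mathbb{R}\cup\{x\in A\mid t(x)\in\mathbb{R},\ n(x)\in\mathbb{R},\ 4n(x)>t(x)^2\}$. $\mathbb{S}_A=\{J\in Q_A\mid J^2=-1\}$, assumed non-empty. One has $Q_A=\bigcup_{J\in\mathbb{S}_A}\mathbb{C}_J$ with $\mathbb{C}_J=\langle 1,J\rangle\simeq\mathbb{C}$. For $x=\alpha+\beta J\in Q_A$, $\mathbb{S}_x=\{\alpha+\beta I\mid I\in\mathbb{S}_A\}$. $\langle a,b\rangle$ denotes the real span. Slice functions. $A_{\mathbb{C}}=A\otimes_{\mathbb{R}}\mathbb{C}=\{x+iy\mid x,y\in A\}$ with product $(x+iy)(x'+iy')=xx'-yy'+i(xy'+yx')$ and conjugation $\overline{x+iy}=x-iy$. $D\subseteq\mathbb{C}$ is open and, without restriction, invariant under complex conjugation. A stem function on $D$ is $F=F_1+iF_2:D\to A_{\mathbb{C}}$ ($F_1,F_2$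 $A$-valued) with $F(\bar z)=\overline{F(z)}$. Let $\Omega_D=\{\alpha+\beta J\mid \alpha,\beta\in\mathbb{R},\ \alpha+i\beta\in D,\ J\in\mathbb{S}_A\}$. The slice function $f=\mathcal{I}(F):\Omega_D\to A$ is $f(\alpha+\beta J)=F_1(\alpha+i\beta)+JF_2(\alpha+i\beta)$. It is slice regular if $F$ is $C^1$ and holomorphic with respect to left multiplication by $i$ on $A_{\mathbb{C}}$; real if $F_1,F_2$ are real-valued; admissible if $\langle F_1(z),F_2(z)\rangle\subseteq N_A$ for every $z\in D$. $V(f)=\{x\in\Omega_D\mid f(x)=0\}$. For $y\in Q_A$, the characteristic polynomial is $\Delta_y(x)=x^2-x\,t(y)+n(y)$, a real slice regular function. Types of zeros. $y\in V(f)$ is a real zero if $y\in\mathbb{R}$; a spherical zero if $y\notin\mathbb{R}$ and $\mathbb{S}_y\subseteq V(f)$; an $\mathbb{S}_A$-isolated non-real zero if $y\notin\mathbb{R}$ and $\mathbb{S}_y\cap V(f)=\{y\}$. *)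

theory Defs
  imports "HOL-Analysis.Analysis"
begin

text \<open>
  A finite-dimensional real alternative algebra with unity and a fixed antiinvolution. The
  multiplication is not associative, so the library's ring classes do not apply. The Euclidean
  structure inherited from \<open>euclidean_space\<close> is unrelated to the multiplication: it encodes
  finite dimension and supplies the canonical topology. The three alternativity axioms say that
  the associator \<open>(x * y) * z - x * (y * z)\<close> vanishes as soon as two of its arguments coincide.
\<close>

class alternative_star_algebra = euclidean_space + times + one +
  fixes star :: "'a \<Rightarrow> 'a"  ("_\<^sup>c" [1000] 999)
  assumes mult_add_left: "(x + y) * z = x * z + y * z"
    and mult_add_right: "x * (y + z) = x * y + x * z"
    and mult_scale_left: "(r *\<^sub>R x) * y = r *\<^sub>R (x * y)"
    and mult_scale_right: "x * (r *\<^sub>R y) = r *\<^sub>R (x * y)"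
    and one_left: "1 * x = x"
    and one_right: "x * 1 = x"
    and alternative_left: "(x * x) * y = x * (x * y)"
    and alternative_right: "(x * y) * y = x * (y * y)"
    and alternative_flexible: "(x * y) * x = x * (y * x)"
    and star_add: "(x + y)\<^sup>c = x\<^sup>c + y\<^sup>c"
    and star_scale: "(r *\<^sub>R x)\<^sup>c = r *\<^sub>R x\<^sup>c"
    and star_star: "(x\<^sup>c)\<^sup>c = x"
    and star_mult: "(x * y)\<^sup>c = y\<^sup>c * x\<^sup>c"
    and star_real: "(r *\<^sub>R 1)\<^sup>c = r *\<^sub>R 1"

definition real_line :: "'a::alternative_star_algebra set"
  where "real_line = range (\<lambda>r. r *\<^sub>R 1)"

definition alg_trace :: "'a::alternative_star_algebra \<Rightarrow> 'a"
  where "alg_trace x = x + x\<^sup>c"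

definition alg_norm :: "'a::alternative_star_algebra \<Rightarrow> 'a"
  where "alg_norm x = x * x\<^sup>c"

definition normal_cone :: "'a::alternative_star_algebra set"
  where "normal_cone =
    {0} \<union> {x. alg_norm x = alg_norm (x\<^sup>c) \<and> alg_norm x \<in> real_line \<and> alg_norm x \<noteq> 0}"

definition quadratic_cone :: "'a::alternative_star_algebra set"
  where "quadratic_cone = real_line \<union>
    {x. \<exists>t n :: real. alg_trace x = t *\<^sub>R 1 \<and> alg_norm x = n *\<^sub>R 1 \<and> 4 * n > t\<^sup>2}"

definition imag_units :: "'a::alternative_star_algebra set"
  where "imag_units = {J \<in> quadratic_cone. J * J = - 1}"

text \<open>
  The representation \<open>x = \<alpha> + \<beta> J\<close> of an element of the quadratic cone is not unique, only up to
  \<open>(\<beta>, J) \<mapsto> (-\<beta>, -J)\<close> (and the choice of \<open>J\<close> if \<open>\<beta> = 0\<close>); the sphere does not depend on it.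
\<close>

definition sphere_of :: "'a::alternative_star_algebra \<Rightarrow> 'a set"
  where "sphere_of x = {\<alpha> *\<^sub>R 1 + \<beta> *\<^sub>R I | \<alpha> \<beta> I J.
    I \<in> imag_units \<and> J \<in> imag_units \<and> x = \<alpha> *\<^sub>R 1 + \<beta> *\<^sub>R J}"

text \<open>
  The complexified algebra \<open>A \<otimes> \<complex>\<close> is modelled on pairs, \<open>(x, y)\<close> standing for \<open>x + i y\<close>.
  Left multiplication by \<open>i\<close> is then \<open>i (x + i y) = - y + i x\<close>.
\<close>

definition imult :: "'a::alternative_star_algebra \<times> 'a \<Rightarrow> 'a \<times> 'a"
  where "imult w = (- snd w, fst w)"

definition conj_complexified :: "'a::alternative_star_algebra \<times> 'a \<Rightarrow> 'a \<times> 'a"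
  where "conj_complexified w = (fst w, - snd w)"

definition stem_function :: "complex set \<Rightarrow> (complex \<Rightarrow> 'a::alternative_star_algebra \<times> 'a) \<Rightarrow> bool"
  where "stem_function D F \<longleftrightarrow> (\<forall>z\<in>D. F (cnj z) = conj_complexified (F z))"

text \<open>Continuously differentiable, with differential complex linear with respect to \<open>imult\<close>.\<close>

definition holomorphic_stem ::
    "complex set \<Rightarrow> (complex \<Rightarrow> 'a::alternative_star_algebra \<times> 'a) \<Rightarrow> bool"
  where "holomorphic_stem D F \<longleftrightarrow>
    (\<exists>F' :: complex \<Rightarrow> complex \<Rightarrow>\<^sub>L ('a \<times> 'a).
      (\<forall>z\<in>D. (F has_derivative blinfun_apply (F' z)) (at z)) \<and>
      continuous_on D F' \<and>
      (\<forall>z\<in>D. \<forall>v. blinfun_apply (F' z) (\<i> * v) = imult (blinfun_apply (F' z) v)))"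

definition slice_domain :: "complex set \<Rightarrow> 'a::alternative_star_algebra set"
  where "slice_domain D = {\<alpha> *\<^sub>R 1 + \<beta> *\<^sub>R J | \<alpha> \<beta> J. Complex \<alpha> \<beta> \<in> D \<and> J \<in> imag_units}"

text \<open>
  \<open>is_slice_function D F f\<close>: \<open>f\<close> is the slice function induced by the stem function \<open>F\<close>. Slice
  functions are total functions whose values outside \<open>slice_domain D\<close> are irrelevant.
\<close>

definition is_slice_function ::
    "complex set \<Rightarrow> (complex \<Rightarrow> 'a::alternative_star_algebra \<times> 'a) \<Rightarrow> ('a \<Rightarrow> 'a) \<Rightarrow> bool"
  where "is_slice_function D F f \<longleftrightarrow> stem_function D F \<and>
    (\<forall>\<alpha> \<beta>. \<forall>J \<in> imag_units. Complex \<alpha> \<beta> \<in> D \<longrightarrow>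
      f (\<alpha> *\<^sub>R 1 + \<beta> *\<^sub>R J) = fst (F (Complex \<alpha> \<beta>)) + J * snd (F (Complex \<alpha> \<beta>)))"

text \<open>
  If \<open>imag_units\<close> is non-empty, a slice function determines its stem function on \<open>D\<close>, so the
  existential quantifiers below range over a single stem function.
\<close>

definition slice_regular :: "complex set \<Rightarrow> ('a::alternative_star_algebra \<Rightarrow> 'a) \<Rightarrow> bool"
  where "slice_regular D f \<longleftrightarrow> (\<exists>F. is_slice_function D F f \<and> holomorphic_stem D F)"

definition real_slice :: "complex set \<Rightarrow> ('a::alternative_star_algebra \<Rightarrow> 'a) \<Rightarrow> bool"
  where "real_slice D f \<longleftrightarrow> (\<exists>F. is_slice_function D F f \<and>
    (\<forall>z\<in>D. fst (F z) \<in> real_line \<and> snd (F z) \<in> real_line))"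

definition admissible_slice :: "complex set \<Rightarrow> ('a::alternative_star_algebra \<Rightarrow> 'a) \<Rightarrow> bool"
  where "admissible_slice D f \<longleftrightarrow> (\<exists>F. is_slice_function D F f \<and>
    (\<forall>z\<in>D. span {fst (F z), snd (F z)} \<subseteq> normal_cone))"

definition zero_set :: "complex set \<Rightarrow> ('a::alternative_star_algebra \<Rightarrow> 'a) \<Rightarrow> 'a set"
  where "zero_set D f = {x \<in> slice_domain D. f x = 0}"

definition real_zero :: "complex set \<Rightarrow> ('a::alternative_star_algebra \<Rightarrow> 'a) \<Rightarrow> 'a \<Rightarrow> bool"
  where "real_zero D f y \<longleftrightarrow> y \<in> zero_set D f \<and> y \<in> real_line"

definition spherical_zero :: "complex set \<Rightarrow> ('a::alternative_star_algebra \<Rightarrow> 'a) \<Rightarrow> 'a \<Rightarrow> bool"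
  where "spherical_zero D f y \<longleftrightarrow>
    y \<in> zero_set D f \<and> y \<notin> real_line \<and> sphere_of y \<subseteq> zero_set D f"

definition isolated_nonreal_zero ::
    "complex set \<Rightarrow> ('a::alternative_star_algebra \<Rightarrow> 'a) \<Rightarrow> 'a \<Rightarrow> bool"
  where "isolated_nonreal_zero D f y \<longleftrightarrow>
    y \<in> zero_set D f \<and> y \<notin> real_line \<and> sphere_of y \<inter> zero_set D f = {y}"

definition char_poly :: "'a::alternative_star_algebra \<Rightarrow> 'a \<Rightarrow> 'a"
  where "char_poly y x = x * x - x * alg_trace y + alg_norm y"

definition is_inverse :: "'a::alternative_star_algebra \<Rightarrow> 'a \<Rightarrow> bool"
  where "is_inverse a a' \<longleftrightarrow> a * a' = 1 \<and> a' * a = 1"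

text \<open>
  There is a real subspace \<open>V\<close> inside the normal cone such that \<open>F\<close> takes values in the
  complexification of \<open>V\<close>, which is \<open>V \<times> V\<close> in the model by pairs.
\<close>

definition stem_in_normal_subspace ::
    "complex set \<Rightarrow> (complex \<Rightarrow> 'a::alternative_star_algebra \<times> 'a) \<Rightarrow> bool"
  where "stem_in_normal_subspace D F \<longleftrightarrow>
    (\<exists>V. subspace V \<and> V \<subseteq> normal_cone \<and> (\<forall>z\<in>D. F z \<in> V \<times> V))"

end

theory Submission
  imports Defs "HOL-Complex_Analysis.Cauchy_Integral_Formula"
begin

text \<open>
  Holomorphy of a stem function can be tested on its complex coordinates, so a zero of \<open>F\<close> can be
  divided out coordinatewise. A real zero \<open>y\<close> of \<open>f\<close> is a zero of \<open>F\<close>. For \<open>y = \<alpha> + \<beta> J\<close> not real and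
  \<open>w = \<alpha> + i \<beta>\<close>, one subtracts from \<open>F\<close> the stem function \<open>z a + b\<close> that agrees with it at \<open>w\<close> and at
  its conjugate, and divides by \<open>(z - w) (z - cnj w)\<close>. Symmetry and the values in a subspace pass to
  the quotient by continuity. On the sphere of \<open>y\<close> the function \<open>f\<close> is \<open>x a + b\<close>, and right
  multiplication by an invertible element is injective by the right Moufang identity; hence \<open>y\<close> is
  the only zero there unless \<open>a = 0\<close>.
\<close>

section \<open>Alternative algebras\<close>

lemma mult_zero_left_alt [simp]: "0 * x = (0::'a::alternative_star_algebra)"
  using mult_scale_left[of 0 0 x] by simp

lemma mult_zero_right_alt [simp]: "x * 0 = (0::'a::alternative_star_algebra)"
  using mult_scale_right[of x 0 0] by simp

lemma mult_minus_left_alt: "(- x) * y = - (x * y)" for x y :: "'a::alternative_star_algebra"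
  using mult_scale_left[of "-1" x y] by simp

lemma mult_minus_right_alt: "x * (- y) = - (x * y)" for x y :: "'a::alternative_star_algebra"
  using mult_scale_right[of x "-1" y] by simp

lemma mult_diff_left_alt: "(x - y) * z = x * z - y * z" for x y z :: "'a::alternative_star_algebra"
  using mult_add_left[of x "- y" z] by (simp add: mult_minus_left_alt)

lemma mult_diff_right_alt: "z * (x - y) = z * x - z * y" for x y z :: "'a::alternative_star_algebra"
  using mult_add_right[of z x "- y"] by (simp add: mult_minus_right_alt)

lemmas alt_algebra_simps = mult_add_left mult_add_right mult_scale_left mult_scale_right
  mult_minus_left_alt mult_minus_right_alt mult_diff_left_alt mult_diff_right_alt
  one_left one_right

lemma star_minus: "(- x)\<^sup>c = - (x\<^sup>c)" for x :: "'a::alternative_star_algebra"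
  using star_scale[of "-1" x] by simp

lemma star_one [simp]: "1\<^sup>c = (1::'a::alternative_star_algebra)"
  using star_real[of 1] by simp

text \<open>If \<open>1\<close> were \<open>0\<close>, every \<open>x = 1 * x\<close> would vanish,
  but a Euclidean space has a nonzero basis vector.\<close>

lemma one_neq_zero_alt: "(1::'a::alternative_star_algebra) \<noteq> 0"
proof
  assume "(1::'a) = 0"
  then have "x = 0" for x :: 'a
    using one_left[of x] by simp
  then show False
    using nonzero_Basis nonempty_Basis by blast
qed

lemma scaleR_one_eq_iff [simp]:
  "r *\<^sub>R (1::'a::alternative_star_algebra) = s *\<^sub>R 1 \<longleftrightarrow> r = s"
  by (simp add: one_neq_zero_alt)

section \<open>Alternating associator, right Moufang identity, and inverses\<close>

definition associator :: "'a::alternative_star_algebra \<Rightarrow> 'a \<Rightarrow> 'a \<Rightarrow> 'a"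
  where "associator x y z = (x * y) * z - x * (y * z)"

text \<open>Polarization of left alternativity: in the expansion for \<open>x + y\<close> the terms
  with \<open>x * x\<close> or \<open>y * y\<close> cancel.\<close>

lemma associator_swap_left: "associator x y z = - associator y x z"
proof -
  have "((x + y) * (x + y)) * z = (x + y) * ((x + y) * z)"
    by (rule alternative_left)
  then have "(x * y) * z + (y * x) * z = x * (y * z) + y * (x * z)"
    by (simp add: mult_add_left mult_add_right alternative_left add.commute)
  then show ?thesis
    by (simp add: associator_def algebra_simps)
qed

lemma associator_swap_right: "associator x y z = - associator x z y"
proof -
  have "(x * (y + z)) * (y + z) = x * ((y + z) * (y + z))"
    by (rule alternative_right)
  then have "(x * y) * z + (x * z) * y = x * (y * z) + x * (z * y)"
    by (simp add: mult_add_left mult_add_right alternative_right add.commute)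
  then show ?thesis
    by (simp add: associator_def algebra_simps)
qed

text \<open>Substitute for associativity in the cancellation of right factors below.\<close>

lemma right_Moufang: "((x * y) * w) * y = x * ((y * w) * y)"
  for x y w :: "'a::alternative_star_algebra"
proof -
  \<comment> \<open>The two associators share the term \<open>(x * y) * (w * y)\<close>, which
    cancels; flexibility identifies \<open>(y * w) * y\<close> with
    \<open>y * (w * y)\<close>.\<close>
  have "((x * y) * w) * y - x * ((y * w) * y) = associator (x * y) w y + associator x y (w * y)"
    by (simp add: associator_def alternative_flexible)
  \<comment> \<open>After the swaps \<open>y\<close> stands last, so right alternativity can merge
    it with the \<open>y\<close> in the factor before it.\<close>
  also have "\<dots> = - associator w (x * y) y - associator x (w * y) y"
    using associator_swap_left[of "x * y" w y] associator_swap_right[of x y "w * y"] by simp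
  also have "\<dots> = (w * (x * (y * y)) + x * (w * (y * y))) - (w * (x * y) + x * (w * y)) * y"
    by (simp add: associator_def alternative_right mult_add_left)
  \<comment> \<open>Antisymmetry in \<open>w\<close> and \<open>x\<close> makes the symmetric sum
    associate, here with \<open>y * y\<close> and below with \<open>y\<close>; then everything
    cancels.\<close>
  also have "w * (x * (y * y)) + x * (w * (y * y)) = (w * x) * (y * y) + (x * w) * (y * y)"
    using associator_swap_left[of w x "y * y"] by (simp add: associator_def algebra_simps)
  also have "\<dots> = ((w * x) * y + (x * w) * y) * y"
    by (simp add: mult_add_left alternative_right)
  also have "(w * x) * y + (x * w) * y = w * (x * y) + x * (w * y)"
    using associator_swap_left[of w x y] by (simp add: associator_def algebra_simps)
  finally show ?thesis by simp
qed

lemma mult_inverse_right_cancel: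
  assumes "is_inverse a a'" and "x * a = 0"
  shows "x = 0"
proof -
  have "(a * (a' * a')) * a = 1"
    using assms(1) alternative_right[of a a'] by (simp add: is_inverse_def one_left)
  then have "x = ((x * a) * (a' * a')) * a"
    using right_Moufang[of x a "a' * a'"] by (simp add: one_right)
  then show ?thesis
    using assms(2) by simp
qed

lemma mult_inverse_right:
  assumes "is_inverse a a'"
  shows "(x * a) * a' = x"
proof -
  \<comment> \<open>The Moufang identity with \<open>w = a'\<close> gives
    \<open>((x * a) * a') * a = x * a\<close>, and right multiplication by \<open>a\<close> can be
    cancelled.\<close>
  have "(((x * a) * a') - x) * a = 0"
    using right_Moufang[of x a a'] assms by (simp add: is_inverse_def one_left mult_diff_left_alt)
  then show ?thesis
    using mult_inverse_right_cancel[OF assms] by fastforce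
qed

text \<open>The inverse is the conjugate divided by the norm; equality of the norms of
  \<open>a\<close> and \<open>a\<^sup>c\<close> makes it two-sided.\<close>

lemma normal_cone_inverse:
  assumes "a \<in> normal_cone" and "a \<noteq> 0"
  obtains a' where "is_inverse a a'"
proof -
  from assms have eq: "alg_norm (a\<^sup>c) = alg_norm a" and "alg_norm a \<in> real_line" "alg_norm a \<noteq> 0"
    unfolding normal_cone_def by auto
  then obtain n where n: "alg_norm a = n *\<^sub>R 1" "n \<noteq> 0"
    by (auto simp: real_line_def)
  have "a * a\<^sup>c = n *\<^sub>R 1" "a\<^sup>c * a = n *\<^sub>R 1"
    using n(1) eq by (simp_all add: alg_norm_def star_star)
  then have "is_inverse a (inverse n *\<^sub>R a\<^sup>c)"
    using n(2) by (simp add: is_inverse_def mult_scale_left mult_scale_right)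
  then show thesis by (rule that)
qed

lemma subspace_real_line: "subspace (real_line :: 'a::alternative_star_algebra set)"
proof -
  have *: "real_line = span {1::'a}"
    by (simp add: real_line_def span_singleton)
  show ?thesis
    unfolding * by (rule subspace_span)
qed

section \<open>Imaginary units and spheres\<close>

lemma imag_unit_mult [simp]: "J \<in> imag_units \<Longrightarrow> J * (J * x) = - x"
  using alternative_left[of J x] by (simp add: imag_units_def mult_minus_left_alt one_left)

lemma imag_unit_square [simp]: "J \<in> imag_units \<Longrightarrow> J * J = - 1"
  by (simp add: imag_units_def)

lemma imag_unit_not_real:
  assumes "J \<in> imag_units"
  shows "J \<notin> real_line"
proof
  assume "J \<in> real_line"
  then obtain r where "J = r *\<^sub>R 1"
    by (auto simp: real_line_def)
  with imag_unit_square[OF assms] have "(r * r) *\<^sub>R (1::'a) = (- 1) *\<^sub>R 1"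
    by (simp add: alt_algebra_simps)
  then have "r * r = - 1"
    unfolding scaleR_one_eq_iff .
  then show False
    by (smt (verit) zero_le_square)
qed

lemma imag_unit_star:
  assumes "J \<in> imag_units"
  shows "J\<^sup>c = - J"
proof -
  from assms obtain t n :: real where tn: "J + J\<^sup>c = t *\<^sub>R 1" "J * J\<^sup>c = n *\<^sub>R 1"
    using imag_unit_not_real[OF assms]
    unfolding imag_units_def quadratic_cone_def alg_trace_def alg_norm_def by blast
  have c: "J\<^sup>c = t *\<^sub>R 1 - J"
    using tn(1) by (simp add: algebra_simps)
  \<comment> \<open>Substituting the conjugate makes the norm equation linear in \<open>J\<close>;
    since \<open>J\<close> is not real, its coefficient \<open>t\<close> must be
    \<open>0\<close>.\<close>
  have "t *\<^sub>R J = (n - 1) *\<^sub>R 1"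
    using tn(2) assms unfolding c by (simp add: alt_algebra_simps scaleR_diff_left eq_diff_eq)
  then have "t *\<^sub>R J \<in> real_line"
    unfolding real_line_def by blast
  from subspace_scale[OF subspace_real_line this, of "inverse t"] have "t = 0"
    using imag_unit_not_real[OF assms] by (cases "t = 0") auto
  then show ?thesis
    using c by simp
qed

lemma imag_unit_minus:
  assumes "J \<in> imag_units"
  shows "- J \<in> imag_units"
proof -
  have "alg_trace (- J) = 0 *\<^sub>R 1" "alg_norm (- J) = 1 *\<^sub>R 1"
    using assms by (simp_all add: alg_trace_def alg_norm_def star_minus imag_unit_star alt_algebra_simps)
  then have "- J \<in> quadratic_cone"
    unfolding quadratic_cone_def by (intro UnI2 CollectI exI[of _ 0] exI[of _ 1]) auto
  moreover have "- J * - J = - 1"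
    using assms by (simp add: alt_algebra_simps)
  ultimately show ?thesis
    unfolding imag_units_def by blast
qed

lemma slice_point_real_iff:
  assumes "J \<in> imag_units"
  shows "\<alpha> *\<^sub>R 1 + \<beta> *\<^sub>R J \<in> real_line \<longleftrightarrow> \<beta> = 0"
proof
  assume "\<alpha> *\<^sub>R 1 + \<beta> *\<^sub>R J \<in> real_line"
  moreover have "\<alpha> *\<^sub>R 1 \<in> (real_line :: 'a set)"
    unfolding real_line_def by (rule rangeI)
  ultimately have "\<beta> *\<^sub>R J \<in> real_line"
    using subspace_diff[OF subspace_real_line] by fastforce
  then have "\<beta> \<noteq> 0 \<Longrightarrow> J \<in> real_line"
    using subspace_scale[OF subspace_real_line, of "\<beta> *\<^sub>R J" "inverse \<beta>"] by simp
  then show "\<beta> = 0"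
    using imag_unit_not_real[OF assms] by blast
qed (auto simp: real_line_def)

text \<open>Conjugation flips the sign of the imaginary part: adding the equation to its conjugate
  isolates \<alpha>, and squaring the imaginary parts determines \<beta> up to sign.\<close>

lemma slice_point_unique:
  assumes "J \<in> imag_units" "J' \<in> imag_units"
    and eq: "\<alpha> *\<^sub>R 1 + \<beta> *\<^sub>R J = \<alpha>' *\<^sub>R 1 + \<beta>' *\<^sub>R J'"
  shows "\<alpha> = \<alpha>'" and "\<beta> *\<^sub>R J = \<beta>' *\<^sub>R J'" and "\<beta>' = \<beta> \<or> \<beta>' = - \<beta>"
proof -
  have "\<alpha> *\<^sub>R 1 - \<beta> *\<^sub>R J = \<alpha>' *\<^sub>R 1 - \<beta>' *\<^sub>R J'"
    using arg_cong[OF eq, of star] assms(1,2)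
    by (simp add: star_add star_scale imag_unit_star)
  note arg_cong2[OF eq this, of plus]
  moreover have "(u + v) + (u - v) = u + u" for u v :: 'a
    by simp
  ultimately have "\<alpha> + \<alpha> = \<alpha>' + \<alpha>'"
    by (simp only: scaleR_add_left[symmetric] scaleR_one_eq_iff)
  then show "\<alpha> = \<alpha>'"
    by simp
  then show *: "\<beta> *\<^sub>R J = \<beta>' *\<^sub>R J'"
    using eq by simp
  have "(\<beta> *\<^sub>R J) * (\<beta> *\<^sub>R J) = (\<beta>' *\<^sub>R J') * (\<beta>' *\<^sub>R J')"
    by (simp add: *)
  then have "(\<beta> * \<beta>) *\<^sub>R (1::'a) = (\<beta>' * \<beta>') *\<^sub>R 1"
    using assms(1,2) by (simp add: alt_algebra_simps)
  then have "\<beta> * \<beta> = \<beta>' * \<beta>'"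
    unfolding scaleR_one_eq_iff .
  then show "\<beta>' = \<beta> \<or> \<beta>' = - \<beta>"
    by (auto simp: square_eq_iff)
qed

text \<open>By uniqueness any other representation changes the imaginary part at most by a sign,
  which the symmetry of \<open>imag_units\<close> absorbs.\<close>

lemma sphere_of_slice_point:
  fixes J :: "'a::alternative_star_algebra"
  assumes "J \<in> imag_units"
  shows "sphere_of (\<alpha> *\<^sub>R 1 + \<beta> *\<^sub>R J) = (\<lambda>I. \<alpha> *\<^sub>R 1 + \<beta> *\<^sub>R I) ` imag_units"
proof (intro equalityI subsetI)
  fix x :: 'a assume "x \<in> sphere_of (\<alpha> *\<^sub>R 1 + \<beta> *\<^sub>R J)"
  then obtain \<alpha>' \<beta>' I J' where x: "x = \<alpha>' *\<^sub>R 1 + \<beta>' *\<^sub>R I" and I: "I \<in> imag_units" "J' \<in> imag_units"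
    and eq: "\<alpha> *\<^sub>R 1 + \<beta> *\<^sub>R J = \<alpha>' *\<^sub>R 1 + \<beta>' *\<^sub>R J'"
    unfolding sphere_of_def by blast
  have "x = \<alpha> *\<^sub>R 1 + \<beta> *\<^sub>R I \<or> x = \<alpha> *\<^sub>R 1 + \<beta> *\<^sub>R (- I)"
    using slice_point_unique[OF assms I(2) eq] x by auto
  then show "x \<in> (\<lambda>I. \<alpha> *\<^sub>R 1 + \<beta> *\<^sub>R I) ` imag_units"
    using I(1) imag_unit_minus by blast
next
  fix x :: 'a assume "x \<in> (\<lambda>I. \<alpha> *\<^sub>R 1 + \<beta> *\<^sub>R I) ` imag_units"
  then show "x \<in> sphere_of (\<alpha> *\<^sub>R 1 + \<beta> *\<^sub>R J)"
    using assms unfolding sphere_of_def by blast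
qed

section \<open>The complexified algebra\<close>

text \<open>The complex vector space structure of the complexified algebra;
  \<open>cscale \<i>\<close> is \<open>imult\<close>.\<close>

definition cscale :: "complex \<Rightarrow> 'a::alternative_star_algebra \<times> 'a \<Rightarrow> 'a \<times> 'a"
  where "cscale z w = (Re z *\<^sub>R fst w - Im z *\<^sub>R snd w, Re z *\<^sub>R snd w + Im z *\<^sub>R fst w)"

lemma cscale_cscale: "cscale z (cscale z' w) = cscale (z * z') w"
  by (simp add: cscale_def prod_eq_iff algebra_simps)

lemma cscale_cancel: "z \<noteq> 0 \<Longrightarrow> cscale (inverse z) (cscale z w) = w"
  by (simp add: cscale_cscale, simp add: cscale_def prod_eq_iff)

lemma cscale_zero [simp]: "cscale z 0 = 0"
  by (simp add: cscale_def prod_eq_iff)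

lemma conj_cscale: "conj_complexified (cscale z w) = cscale (cnj z) (conj_complexified w)"
  by (simp add: cscale_def conj_complexified_def prod_eq_iff algebra_simps)

lemma cscale_mem_subspace: "subspace V \<Longrightarrow> w \<in> V \<times> V \<Longrightarrow> cscale z w \<in> V \<times> V"
  by (auto simp: cscale_def mem_Times_iff intro!: subspace_add subspace_diff subspace_scale)

section \<open>Complex coordinates and holomorphy\<close>

definition coord :: "'a::alternative_star_algebra \<Rightarrow> 'a \<times> 'a \<Rightarrow> complex"
  where "coord b w = Complex (fst w \<bullet> b) (snd w \<bullet> b)"

text \<open>A real basis of the algebra, embedded as \<open>(b, 0)\<close>, is a complex basis of
  its complexification; this inverts \<open>coord\<close>.\<close>

definition of_coords :: "('a \<Rightarrow> complex) \<Rightarrow> 'a::alternative_star_algebra \<times> 'a"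
  where "of_coords c = (\<Sum>b\<in>Basis. cscale (c b) (b, 0))"

lemma coord_cscale: "coord b (cscale z w) = z * coord b w"
  by (simp add: coord_def cscale_def complex_eq_iff inner_simps)

lemma coord_imult: "coord b (imult w) = \<i> * coord b w"
  by (simp add: coord_def imult_def complex_eq_iff)

lemma coord_diff: "coord b (w - w') = coord b w - coord b w'"
  by (simp add: coord_def complex_eq_iff inner_simps)

lemma coord_eqI: "(\<And>b. b \<in> Basis \<Longrightarrow> coord b w = coord b w') \<Longrightarrow> w = w'"
  by (simp add: coord_def prod_eq_iff euclidean_eq_iff[where 'a = 'a])

lemma bounded_linear_coord: "bounded_linear (coord b)"
  unfolding coord_def Complex_eq
  by (intro bounded_linear_intros bounded_linear_compose[OF bounded_linear_of_real])

lemma coord_of_coords: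
  assumes "b \<in> Basis"
  shows "coord b (of_coords c) = c b"
proof -
  have "coord b (of_coords c) = (\<Sum>b'\<in>Basis. c b' * coord b (b', 0))"
    unfolding of_coords_def
    by (simp add: linear_sum[OF bounded_linear.linear[OF bounded_linear_coord]] coord_cscale)
  also have "\<dots> = (\<Sum>b'\<in>Basis. if b' = b then c b' else 0)"
    using assms by (intro sum.cong) (auto simp: coord_def inner_Basis complex_eq_iff)
  finally show ?thesis
    using assms by simp
qed

lemma of_coords_coord: "of_coords (\<lambda>b. coord b w) = w"
  by (rule coord_eqI) (simp add: coord_of_coords)

lemma bounded_linear_cscale_left: "bounded_linear (\<lambda>z. cscale z w)"
  unfolding cscale_def
  by (intro bounded_linear_intros bounded_linear_Re bounded_linear_Im)

text \<open>Bridge to scalar complex analysis. A complex linear differential gives every coordinate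
  a complex derivative; conversely, derivatives of holomorphic functions are continuous, so the
  assembled differential is too.\<close>

lemma holomorphic_stem_iff_coord:
  fixes F :: "complex \<Rightarrow> 'a::alternative_star_algebra \<times> 'a"
  assumes "open D"
  shows "holomorphic_stem D F \<longleftrightarrow> (\<forall>b\<in>Basis. (\<lambda>z. coord b (F z)) holomorphic_on D)"
proof
  assume "holomorphic_stem D F"
  then obtain F' :: "complex \<Rightarrow> complex \<Rightarrow>\<^sub>L ('a \<times> 'a)"
    where F': "\<And>z. z \<in> D \<Longrightarrow> (F has_derivative blinfun_apply (F' z)) (at z)"
      and lin: "\<And>z v. z \<in> D \<Longrightarrow> blinfun_apply (F' z) (\<i> * v) = imult (blinfun_apply (F' z) v)"
    unfolding holomorphic_stem_def by blast
  show "\<forall>b\<in>Basis. (\<lambda>z. coord b (F z)) holomorphic_on D"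
  proof
    fix b :: 'a
    have "((\<lambda>z. coord b (F z)) has_field_derivative coord b (F' z 1)) (at z)" if z: "z \<in> D" for z
    proof -
      \<comment> \<open>By complex linearity the differential is determined by its value at
        \<open>1\<close>.\<close>
      have "coord b (F' z v) = coord b (F' z 1) * v" for v
      proof -
        interpret L: bounded_linear "\<lambda>v. coord b (F' z v)"
          by (intro bounded_linear_compose[OF bounded_linear_coord] blinfun.bounded_linear_right)
        have "coord b (F' z v) = coord b (F' z (Re v *\<^sub>R 1 + Im v *\<^sub>R (\<i> * 1)))"
          by (simp add: complex_eq[symmetric] scaleR_conv_of_real mult.commute)
        also have "\<dots> = Re v *\<^sub>R coord b (F' z 1) + Im v *\<^sub>R (\<i> * coord b (F' z 1))"
          unfolding L.add L.scaleR lin[OF z] coord_imult ..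
        finally show ?thesis
          by (simp add: complex_eq_iff algebra_simps)
      qed
      then have eq: "(\<lambda>v. coord b (F' z v)) = (*) (coord b (F' z 1))"
        by (rule ext)
      show ?thesis
        using bounded_linear.has_derivative[OF bounded_linear_coord F'[OF z], of b]
        unfolding has_field_derivative_def eq .
    qed
    then show "(\<lambda>z. coord b (F z)) holomorphic_on D"
      using assms holomorphic_on_open by blast
  qed
next
  assume hol: "\<forall>b\<in>Basis. (\<lambda>z. coord b (F z)) holomorphic_on D"
  define c where "c b z = coord b (F z)" for b z
  define L where "L z v = of_coords (\<lambda>b. v * deriv (c b) z)" for z v
  have bl: "bounded_linear (L z)" for z
    unfolding L_def of_coords_def
    by (intro bounded_linear_sum bounded_linear_compose[OF bounded_linear_cscale_left] bounded_linear_mult_left)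
  have F: "F = (\<lambda>z. of_coords (\<lambda>b. c b z))"
    unfolding c_def of_coords_coord ..
  have der: "(F has_derivative L z) (at z)" if "z \<in> D" for z
    unfolding F L_def of_coords_def
  proof (intro has_derivative_sum bounded_linear.has_derivative[OF bounded_linear_cscale_left])
    fix b :: 'a assume "b \<in> Basis"
    then have "(c b has_field_derivative deriv (c b) z) (at z)"
      using hol assms that unfolding c_def by (intro holomorphic_derivI) auto
    then show "(c b has_derivative (\<lambda>v. v * deriv (c b) z)) (at z)"
      by (simp add: has_field_derivative_def mult.commute[of _ "deriv (c b) z"])
  qed
  \<comment> \<open>The differentials act on a finite-dimensional space, so continuity in operator
    norm can be tested in each direction \<open>i\<close>.\<close>
  have cont: "continuous_on D (\<lambda>z. Blinfun (L z))"
  proof (rule continuous_on_blinfun_componentwise)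
    fix i :: complex
    have "continuous_on D (deriv (c b))" if "b \<in> Basis" for b
      using hol assms that unfolding c_def by (intro holomorphic_on_imp_continuous_on holomorphic_deriv) auto
    then have "continuous_on D (\<lambda>z. L z i)"
      unfolding L_def of_coords_def
      by (intro continuous_intros bounded_linear.continuous_on[OF bounded_linear_cscale_left]) auto
    then show "continuous_on D (\<lambda>z. blinfun_apply (Blinfun (L z)) i)"
      by (simp add: bounded_linear_Blinfun_apply bl)
  qed
  have im: "L z (\<i> * v) = imult (L z v)" for z v
    by (rule coord_eqI) (simp add: L_def coord_of_coords coord_imult)
  show "holomorphic_stem D F"
    unfolding holomorphic_stem_def
    using der cont im by (intro exI[of _ "\<lambda>z. Blinfun (L z)"]) (simp add: bounded_linear_Blinfun_apply bl)
qed

section \<open>Quotients of stem functions\<close>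

lemma holomorphic_stem_continuous:
  assumes "holomorphic_stem D F"
  shows "continuous_on D F"
proof (rule continuous_at_imp_continuous_on, intro ballI)
  fix z assume "z \<in> D"
  with assms obtain F' where "(F has_derivative F') (at z)"
    unfolding holomorphic_stem_def by blast
  then show "isCont F z"
    by (rule has_derivative_continuous)
qed

lemma holomorphic_divide_root:
  fixes c :: "complex \<Rightarrow> complex"
  assumes "open D" "c holomorphic_on D" "c w = 0"
  obtains d where "d holomorphic_on D" "\<And>z. z \<in> D \<Longrightarrow> c z = (z - w) * d z"
proof
  \<comment> \<open>Removable singularity: the quotient is filled in at \<open>w\<close> with the
    derivative of \<open>c\<close>.\<close>
  let ?d = "\<lambda>z. if z = w then deriv c w else c z / (z - w)"
  show "?d holomorphic_on D"
    by (rule pole_theorem_open_0[OF assms(2,1), of w]) (use assms(3) in simp_all)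
  show "c z = (z - w) * ?d z" for z
    using assms(3) by simp
qed

lemma holomorphic_stem_divide_root:
  fixes F :: "complex \<Rightarrow> 'a::alternative_star_algebra \<times> 'a"
  assumes "open D" "holomorphic_stem D F" "w \<in> D" "F w = 0"
  obtains G where "holomorphic_stem D G" "\<forall>z\<in>D. F z = cscale (z - w) (G z)"
proof -
  have "\<exists>d. d holomorphic_on D \<and> (\<forall>z\<in>D. coord b (F z) = (z - w) * d z)" if "b \<in> Basis" for b
  proof -
    have "coord b (F w) = 0"
      by (simp add: assms(4) coord_def complex_eq_iff)
    moreover have "(\<lambda>z. coord b (F z)) holomorphic_on D"
      using assms(1,2) that holomorphic_stem_iff_coord by blast
    ultimately show ?thesis
      using holomorphic_divide_root[OF assms(1)] by metis
  qed
  then obtain d where d: "\<And>b. b \<in> Basis \<Longrightarrow> d b holomorphic_on D"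
    "\<And>b z. b \<in> Basis \<Longrightarrow> z \<in> D \<Longrightarrow> coord b (F z) = (z - w) * d b z"
    by metis
  show thesis
  proof
    show "holomorphic_stem D (\<lambda>z. of_coords (\<lambda>b. d b z))"
      using d(1) by (simp add: holomorphic_stem_iff_coord assms(1) coord_of_coords)
    show "\<forall>z\<in>D. F z = cscale (z - w) (of_coords (\<lambda>b. d b z))"
      by (intro ballI coord_eqI) (simp add: coord_cscale coord_of_coords d(2))
  qed
qed

text \<open>Every point of \<open>D\<close> is a limit of points outside the finite set
  \<open>S\<close>. This carries properties of a quotient over to the roots of the divisor.\<close>

lemma continuous_on_closed_except_finite:
  fixes G :: "complex \<Rightarrow> 'b::topological_space"
  assumes "open D" "continuous_on D G" "closed P" "finite S"
    and "\<And>z. z \<in> D - S \<Longrightarrow> G z \<in> P" and "z \<in> D"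
  shows "G z \<in> P"
proof (rule Lim_in_closed_set)
  \<comment> \<open>\<open>z\<close> itself may lie in \<open>S\<close> and is kept; removing it
    afterwards leaves a punctured neighbourhood that avoids all of \<open>S\<close>.\<close>
  have "open (D - (S - {z}))"
    using assms(1,4) by (intro open_Diff finite_imp_closed finite_Diff)
  then have "\<forall>\<^sub>F x in at z. x \<in> D - (S - {z}) - {z}"
    using assms(6) by (intro eventually_at_in_open) simp_all
  then show "\<forall>\<^sub>F x in at z. G x \<in> P"
    by (rule eventually_mono) (blast intro: assms(5))
  show "(G \<longlongrightarrow> G z) (at z)"
    using assms(1,2,6) by (simp add: continuous_on_eq_continuous_at isCont_def)
qed (simp_all add: assms(3))

text \<open>Away from the roots of \<open>p\<close> the symmetric factor cancels from the symmetry
  of \<open>R\<close>; continuity settles the roots.\<close>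

lemma stem_function_quotient:
  assumes D: "open D" "\<forall>z\<in>D. cnj z \<in> D"
    and G: "holomorphic_stem D G"
    and R: "stem_function D R" "\<forall>z\<in>D. R z = cscale (p z) (G z)"
    and p: "\<forall>z. p (cnj z) = cnj (p z)" "finite {z \<in> D. p z = 0}"
  shows "stem_function D G"
proof -
  note cG = holomorphic_stem_continuous[OF G]
  \<comment> \<open>Symmetry is phrased as membership in the closed set \<open>{0}\<close> to fit
    the continuity lemma.\<close>
  have "G (cnj z) - conj_complexified (G z) \<in> {0}" if z: "z \<in> D" for z
  proof (rule continuous_on_closed_except_finite[OF D(1) _ _ p(2) _ z])
    have "continuous_on D (\<lambda>z. G (cnj z))"
      using D(2) by (intro continuous_on_compose2[OF cG] continuous_intros) blast
    then show "continuous_on D (\<lambda>z. G (cnj z) - conj_complexified (G z))"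
      unfolding conj_complexified_def by (intro continuous_intros cG)
    fix x assume x: "x \<in> D - {z \<in> D. p z = 0}"
    then have "cscale (cnj (p x)) (G (cnj x)) = cscale (cnj (p x)) (conj_complexified (G x))"
      using R D(2) p(1) by (metis DiffD1 conj_cscale stem_function_def)
    then have "G (cnj x) = conj_complexified (G x)"
      using x cscale_cancel[of "cnj (p x)"] by (metis (mono_tags, lifting) DiffD1 DiffD2 complex_cnj_zero_iff mem_Collect_eq)
    then show "G (cnj x) - conj_complexified (G x) \<in> {0}" by simp
  qed simp
  then show ?thesis
    by (simp add: stem_function_def)
qed

text \<open>\<open>V \<times> V\<close> is stable under complex scalars, hence under division by
  \<open>p z\<close>, and closed by finite dimension, so the roots are reached too.\<close>

lemma stem_quotient_in_subspace:
  assumes D: "open D" and G: "holomorphic_stem D G"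
    and R: "\<forall>z\<in>D. R z = cscale (p z) (G z)"
    and p: "finite {z \<in> D. p z = 0}"
    and V: "subspace V" "\<forall>z\<in>D. R z \<in> V \<times> V" and z: "z \<in> D"
  shows "G z \<in> V \<times> V"
proof (rule continuous_on_closed_except_finite[OF D holomorphic_stem_continuous[OF G] _ p _ z])
  show "closed (V \<times> V)"
    using V(1) by (intro closed_Times closed_subspace)
  fix x assume x: "x \<in> D - {z \<in> D. p z = 0}"
  then have "G x = cscale (inverse (p x)) (R x)"
    using R by (simp add: cscale_cancel)
  then show "G x \<in> V \<times> V"
    using x V by (metis DiffD1 cscale_mem_subspace)
qed

section \<open>Slice functions\<close>

lemma is_slice_functionD:
  "is_slice_function D F f \<Longrightarrow> J \<in> imag_units \<Longrightarrow> Complex \<alpha> \<beta> \<in> D \<Longrightarrow>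
    f (\<alpha> *\<^sub>R 1 + \<beta> *\<^sub>R J) = fst (F (Complex \<alpha> \<beta>)) + J * snd (F (Complex \<alpha> \<beta>))"
  by (simp add: is_slice_function_def)

text \<open>Half the sum of the values for \<open>J\<close> and \<open>- J\<close> is the first
  component; left multiplication by \<open>J\<close> is injective because
  \<open>J * (J * v) = - v\<close>.\<close>

lemma add_sub_imag_unit_mult_eqD:
  assumes J: "J \<in> imag_units"
    and "u + J * v = u' + J * v'" "u + (- J) * v = u' + (- J) * v'"
  shows "u = u'" and "v = v'"
proof -
  have "2 *\<^sub>R u = (u + J * v) + (u + (- J) * v)" "2 *\<^sub>R u' = (u' + J * v') + (u' + (- J) * v')"
    by (simp_all add: mult_minus_left_alt scaleR_2)
  then have "2 *\<^sub>R u = 2 *\<^sub>R u'"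
    using assms by simp
  then show u: "u = u'" by simp
  then have "J * v = J * v'"
    using assms by simp
  then have "J * (J * v) = J * (J * v')"
    by simp
  then show "v = v'"
    using J by simp
qed

text \<open>Makes the stem functions hidden in the existential definitions interchangeable on
  \<open>D\<close>.\<close>

lemma slice_function_stem_unique:
  fixes f :: "'a::alternative_star_algebra \<Rightarrow> 'a"
  assumes "(imag_units :: 'a set) \<noteq> {}" "is_slice_function D F f" "is_slice_function D G f" "z \<in> D"
  shows "F z = G z"
proof -
  obtain J :: 'a where J: "J \<in> imag_units"
    using assms(1) by blast
  have eq: "fst (F z) + I * snd (F z) = fst (G z) + I * snd (G z)" if "I \<in> imag_units" for I
    using is_slice_functionD[OF assms(2) that, of "Re z" "Im z"]
      is_slice_functionD[OF assms(3) that, of "Re z" "Im z"] assms(4) by simp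
  show ?thesis
    using add_sub_imag_unit_mult_eqD[OF J eq[OF J] eq[OF imag_unit_minus[OF J]]]
    by (simp add: prod_eq_iff)
qed

lemma stem_function_snd_real_eq_0:
  assumes "stem_function D F" "Complex \<alpha> 0 \<in> D"
  shows "snd (F (Complex \<alpha> 0)) = 0"
proof -
  have "cnj (Complex \<alpha> 0) = Complex \<alpha> 0"
    by (simp add: complex_eq_iff)
  then have "snd (F (Complex \<alpha> 0)) = - snd (F (Complex \<alpha> 0))"
    using assms unfolding stem_function_def conj_complexified_def by (metis snd_conv)
  then show ?thesis
    by (simp add: eq_neg_iff_add_eq_0 flip: scaleR_2)
qed

text \<open>A simultaneous sign change of \<beta> and the unit is compensated by stem symmetry; for
  \<beta> = 0 the unit is arbitrary, but the second component vanishes.\<close>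

lemma stem_value_well_defined:
  assumes st: "stem_function D F"
    and J: "J \<in> imag_units" "J' \<in> imag_units" and z: "Complex \<alpha> \<beta> \<in> D"
    and eq: "\<alpha> *\<^sub>R 1 + \<beta> *\<^sub>R J = \<alpha>' *\<^sub>R 1 + \<beta>' *\<^sub>R J'"
  shows "fst (F (Complex \<alpha> \<beta>)) + J * snd (F (Complex \<alpha> \<beta>)) =
    fst (F (Complex \<alpha>' \<beta>')) + J' * snd (F (Complex \<alpha>' \<beta>'))"
proof -
  note u = slice_point_unique[OF J eq]
  consider "\<beta> = 0" "\<beta>' = 0" | "\<beta> \<noteq> 0" "\<beta>' = \<beta>" "J' = J" | "\<beta> \<noteq> 0" "\<beta>' = - \<beta>" "J' = - J"
    using u(2,3) by (cases "\<beta> = 0") (auto simp flip: scaleR_minus_right)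
  then show ?thesis
  proof cases
    case 1
    then show ?thesis
      using u(1) stem_function_snd_real_eq_0[OF st, of \<alpha>] z by simp
  next
    case 2
    then show ?thesis
      using u(1) by simp
  next
    case 3
    then have "Complex \<alpha>' \<beta>' = cnj (Complex \<alpha> \<beta>)"
      using u(1) by (simp add: complex_eq_iff)
    then show ?thesis
      using st z 3 by (simp add: stem_function_def conj_complexified_def mult_minus_left_alt mult_minus_right_alt)
  qed
qed

lemma stem_function_induces_slice_function:
  fixes G :: "complex \<Rightarrow> 'a::alternative_star_algebra \<times> 'a"
  assumes "stem_function D G"
  obtains g where "is_slice_function D G g"
proof -
  \<comment> \<open>\<open>Q\<close> is the graph of the wanted function; the choice below is forced
    on the slice domain and arbitrary elsewhere.\<close>
  define Q where "Q x v \<longleftrightarrow> (\<exists>\<alpha> \<beta> J. J \<in> imag_units \<and> Complex \<alpha> \<beta> \<in> D \<and> x = \<alpha> *\<^sub>R 1 + \<beta> *\<^sub>R J \<and>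
    v = fst (G (Complex \<alpha> \<beta>)) + J * snd (G (Complex \<alpha> \<beta>)))" for x v
  have uniq: "v = v'" if "Q x v" "Q x v'" for x v v'
    using that stem_value_well_defined[OF assms] unfolding Q_def by metis
  have "(SOME v. Q (\<alpha> *\<^sub>R 1 + \<beta> *\<^sub>R J) v) = fst (G (Complex \<alpha> \<beta>)) + J * snd (G (Complex \<alpha> \<beta>))"
    if "J \<in> imag_units" "Complex \<alpha> \<beta> \<in> D" for \<alpha> \<beta> J
  proof -
    have "Q (\<alpha> *\<^sub>R 1 + \<beta> *\<^sub>R J) (fst (G (Complex \<alpha> \<beta>)) + J * snd (G (Complex \<alpha> \<beta>)))"
      using that unfolding Q_def by blast
    then show ?thesis
      using uniq by (intro some_equality) auto
  qed
  then have "is_slice_function D G (\<lambda>x. SOME v. Q x v)"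
    using assms by (simp add: is_slice_function_def)
  then show thesis by (rule that)
qed

text \<open>Translates complex scaling of a stem into multiplication in the algebra; the only triple
  products are \<open>J * (J * v)\<close>, governed by left alternativity.\<close>

lemma slice_value_cscale:
  assumes "J \<in> imag_units"
  shows "(Re z *\<^sub>R 1 + Im z *\<^sub>R J) * (fst w + J * snd w) = fst (cscale z w) + J * snd (cscale z w)"
  using assms by (simp add: cscale_def alt_algebra_simps algebra_simps)

text \<open>Trace and norm of the point are \<open>2 * Re w\<close> and the squared modulus of
  \<open>w\<close>, up to sign the coefficients of \<open>(z - w) * (z - cnj w)\<close>. As they are
  real, evaluation in the plane of \<open>I\<close> is complex arithmetic.\<close>

lemma char_poly_slice_point:
  assumes "J \<in> imag_units" "I \<in> imag_units"
    and c: "c = (z - w) * (z - cnj w)"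
  shows "char_poly (Re w *\<^sub>R 1 + Im w *\<^sub>R J) (Re z *\<^sub>R 1 + Im z *\<^sub>R I) = Re c *\<^sub>R 1 + Im c *\<^sub>R I"
proof -
  have t: "alg_trace (Re w *\<^sub>R 1 + Im w *\<^sub>R J) = (2 * Re w) *\<^sub>R 1"
    using assms(1) by (simp add: alg_trace_def star_add star_scale imag_unit_star flip: scaleR_add_left)
  have n: "alg_norm (Re w *\<^sub>R 1 + Im w *\<^sub>R J) = (Re w * Re w + Im w * Im w) *\<^sub>R 1"
    using assms(1)
    by (simp add: alg_norm_def star_add star_scale imag_unit_star alt_algebra_simps algebra_simps)
  show ?thesis
    using assms(2) unfolding char_poly_def t n c
    by (simp add: alt_algebra_simps algebra_simps) (simp flip: scaleR_add_left)
qed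

section \<open>Factorization at a zero\<close>

text \<open>Common final stage of both factorizations: \<open>p z\<close> is
  \<open>z - Complex \<alpha> 0\<close> at a real zero and \<open>(z - w) * (z - cnj w)\<close>
  otherwise. Inheritance of values in a subspace yields both admissibility and reality.\<close>

lemma slice_function_quotient:
  fixes G R :: "complex \<Rightarrow> 'a::alternative_star_algebra \<times> 'a"
  assumes D: "open D" "\<forall>z\<in>D. cnj z \<in> D"
    and G: "holomorphic_stem D G"
    and R: "stem_function D R" "\<forall>z\<in>D. R z = cscale (p z) (G z)"
    and p: "\<forall>z. p (cnj z) = cnj (p z)" "finite {z \<in> D. p z = 0}"
  obtains g where "is_slice_function D G g" "slice_regular D g"
    and "\<forall>V. subspace V \<and> V \<subseteq> normal_cone \<and> (\<forall>z\<in>D. R z \<in> V \<times> V) \<longrightarrow> admissible_slice D g"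
    and "(\<forall>z\<in>D. R z \<in> real_line \<times> real_line) \<longrightarrow> real_slice D g"
proof -
  obtain g where g: "is_slice_function D G g"
    using stem_function_induces_slice_function stem_function_quotient[OF D G R p] by blast
  note mem = stem_quotient_in_subspace[OF D(1) G R(2) p(2)]
  show thesis
  proof
    show "is_slice_function D G g" by (rule g)
    show "slice_regular D g"
      using g G by (auto simp: slice_regular_def)
    show "\<forall>V. subspace V \<and> V \<subseteq> normal_cone \<and> (\<forall>z\<in>D. R z \<in> V \<times> V) \<longrightarrow> admissible_slice D g"
    proof (intro allI impI, elim conjE)
      fix V :: "'a set"
      assume V: "subspace V" "V \<subseteq> normal_cone" "\<forall>z\<in>D. R z \<in> V \<times> V"
      have "span {fst (G z), snd (G z)} \<subseteq> normal_cone" if "z \<in> D" for z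
        using mem[OF V(1,3) that] V(1,2) by (intro order_trans[OF span_minimal]) (auto simp: mem_Times_iff)
      then show "admissible_slice D g"
        using g by (auto simp: admissible_slice_def)
    qed
    show "(\<forall>z\<in>D. R z \<in> real_line \<times> real_line) \<longrightarrow> real_slice D g"
    proof
      assume "\<forall>z\<in>D. R z \<in> real_line \<times> real_line"
      from mem[OF subspace_real_line this] g show "real_slice D g"
        by (auto simp: real_slice_def mem_Times_iff)
    qed
  qed
qed

lemma real_zero_factorization:
  fixes f :: "'a::alternative_star_algebra \<Rightarrow> 'a"
  assumes D: "open D" "\<forall>z\<in>D. cnj z \<in> D"
    and F: "is_slice_function D F f" "holomorphic_stem D F"
    and y: "real_zero D f y"
  obtains g where "slice_regular D g" "\<forall>x\<in>slice_domain D. f x = (x - y) * g x"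
    and "\<forall>V. subspace V \<and> V \<subseteq> normal_cone \<and> (\<forall>z\<in>D. F z \<in> V \<times> V) \<longrightarrow> admissible_slice D g"
    and "(\<forall>z\<in>D. F z \<in> real_line \<times> real_line) \<longrightarrow> real_slice D g"
proof -
  from y obtain \<alpha> \<beta> J where yJ: "y = \<alpha> *\<^sub>R 1 + \<beta> *\<^sub>R J" "Complex \<alpha> \<beta> \<in> D" "J \<in> imag_units"
    by (auto simp: real_zero_def zero_set_def slice_domain_def)
  have "\<beta> = 0"
    using y yJ slice_point_real_iff by (auto simp: real_zero_def)
  with yJ have y\<alpha>: "y = \<alpha> *\<^sub>R 1" and \<alpha>: "Complex \<alpha> 0 \<in> D"
    by auto
  have st: "stem_function D F"
    using F(1) by (simp add: is_slice_function_def)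
  \<comment> \<open>At a real point stem symmetry kills the second component, so
    \<open>f y = 0\<close> forces the whole value of \<open>F\<close> to vanish.\<close>
  have "snd (F (Complex \<alpha> 0)) = 0"
    using stem_function_snd_real_eq_0[OF st \<alpha>] .
  moreover from this have "fst (F (Complex \<alpha> 0)) = 0"
    using is_slice_functionD[OF F(1) yJ(3) \<alpha>] y by (simp add: y\<alpha> real_zero_def zero_set_def)
  ultimately have F0: "F (Complex \<alpha> 0) = 0"
    by (simp add: prod_eq_iff)
  obtain G where G: "holomorphic_stem D G"
    and FG: "\<forall>z\<in>D. F z = cscale (z - Complex \<alpha> 0) (G z)"
    using holomorphic_stem_divide_root[OF D(1) F(2) \<alpha> F0] .
  have fin: "finite {z \<in> D. z - Complex \<alpha> 0 = 0}"
    by (rule finite_subset[of _ "{Complex \<alpha> 0}"]) auto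
  have cn: "\<forall>z. cnj z - Complex \<alpha> 0 = cnj (z - Complex \<alpha> 0)"
    by (simp add: complex_eq_iff)
  obtain g where g: "is_slice_function D G g" "slice_regular D g"
    and gV: "\<forall>V. subspace V \<and> V \<subseteq> normal_cone \<and> (\<forall>z\<in>D. F z \<in> V \<times> V) \<longrightarrow> admissible_slice D g"
      "(\<forall>z\<in>D. F z \<in> real_line \<times> real_line) \<longrightarrow> real_slice D g"
    using slice_function_quotient[OF D G st FG cn fin] .
  have "\<forall>x\<in>slice_domain D. f x = (x - y) * g x"
  proof
    fix x :: 'a assume "x \<in> slice_domain D"
    then obtain p q I where x: "x = p *\<^sub>R 1 + q *\<^sub>R I" "Complex p q \<in> D" "I \<in> imag_units"
      by (auto simp: slice_domain_def)
    let ?c = "Complex p q - Complex \<alpha> 0"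
    have xy: "x - y = Re ?c *\<^sub>R 1 + Im ?c *\<^sub>R I"
      by (simp add: x(1) y\<alpha> scaleR_diff_left)
    show "f x = (x - y) * g x"
      unfolding xy unfolding x(1) is_slice_functionD[OF g(1) x(3,2)] is_slice_functionD[OF F(1) x(3,2)]
        slice_value_cscale[OF x(3)] bspec[OF FG x(2)] ..
  qed
  from that[OF g(2) this gV] show thesis .
qed

text \<open>The pair \<open>(a, b)\<close> is chosen such that the stem function \<open>z a + b\<close> interpolates \<open>F\<close> at \<open>w\<close>, and
  hence, by the symmetry of stem functions, also at \<open>cnj w\<close>.\<close>

lemma nonreal_factorization:
  fixes f :: "'a::alternative_star_algebra \<Rightarrow> 'a"
  assumes D: "open D" "\<forall>z\<in>D. cnj z \<in> D"
    and F: "is_slice_function D F f" "holomorphic_stem D F"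
    and y: "y = \<alpha> *\<^sub>R 1 + \<beta> *\<^sub>R J" "J \<in> imag_units"
    and w: "w = Complex \<alpha> \<beta>" "w \<in> D" "\<beta> \<noteq> 0"
    and a: "a = inverse \<beta> *\<^sub>R snd (F w)" and b: "b = fst (F w) - \<alpha> *\<^sub>R a"
  obtains h where "slice_regular D h"
    and "\<forall>x\<in>slice_domain D. f x = char_poly y x * h x + x * a + b"
    and "\<forall>V. subspace V \<and> V \<subseteq> normal_cone \<and> (\<forall>z\<in>D. F z \<in> V \<times> V) \<longrightarrow> admissible_slice D h"
    and "(\<forall>z\<in>D. F z \<in> real_line \<times> real_line) \<longrightarrow> real_slice D h"
proof -
  have stF: "stem_function D F"
    using F(1) by (simp add: is_slice_function_def)
  \<comment> \<open>The remainder after interpolation; \<open>a\<close> and \<open>b\<close> enter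
    as \<open>(a, 0)\<close> and \<open>(b, 0)\<close>, which keeps it symmetric.\<close>
  define R where "R z = F z - cscale z (a, 0) - (b, 0)" for z
  have stR: "stem_function D R"
    using stF by (simp add: stem_function_def R_def conj_complexified_def cscale_def)
  have hR: "holomorphic_stem D R"
    using F(2) D(1)
    by (auto simp: holomorphic_stem_iff_coord R_def coord_diff coord_cscale intro!: holomorphic_intros)
  have Rw: "R w = 0"
    using w(1,3) by (simp add: R_def a b cscale_def prod_eq_iff)
  obtain G where G: "holomorphic_stem D G" and RG: "\<forall>z\<in>D. R z = cscale (z - w) (G z)"
    using holomorphic_stem_divide_root[OF D(1) hR w(2) Rw] .
  \<comment> \<open>\<beta> \<noteq> 0 separates \<open>w\<close> from \<open>cnj w\<close>, so the
    factor \<open>z - w\<close> can be cancelled at \<open>cnj w\<close> and \<open>G\<close>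
    vanishes there.\<close>
  have cw: "cnj w \<in> D" "cnj w - w \<noteq> 0"
    using D(2) w by (auto simp: complex_eq_iff)
  have "R (cnj w) = 0"
    using stR w(2) Rw by (simp add: stem_function_def conj_complexified_def zero_prod_def)
  then have G0: "G (cnj w) = 0"
    using bspec[OF RG cw(1)] cscale_cancel[OF cw(2)] cscale_zero by metis
  obtain H where H: "holomorphic_stem D H" and GH: "\<forall>z\<in>D. G z = cscale (z - cnj w) (H z)"
    using holomorphic_stem_divide_root[OF D(1) G cw(1) G0] .
  define p where "p z = (z - w) * (z - cnj w)" for z
  have RH: "\<forall>z\<in>D. R z = cscale (p z) (H z)"
    using RG GH by (simp add: cscale_cscale p_def)
  have fin: "finite {z \<in> D. p z = 0}"
    by (rule finite_subset[of _ "{w, cnj w}"]) (auto simp: p_def)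
  have cn: "\<forall>z. p (cnj z) = cnj (p z)"
    by (simp add: p_def mult.commute)
  obtain h where h: "is_slice_function D H h" "slice_regular D h"
    and hV: "\<forall>V. subspace V \<and> V \<subseteq> normal_cone \<and> (\<forall>z\<in>D. R z \<in> V \<times> V) \<longrightarrow> admissible_slice D h"
      "(\<forall>z\<in>D. R z \<in> real_line \<times> real_line) \<longrightarrow> real_slice D h"
    using slice_function_quotient[OF D H stR RH cn fin] .
  \<comment> \<open>\<open>a\<close> and \<open>b\<close> are real combinations of the components of
    \<open>F w\<close>, so the subtraction stays within \<open>V \<times> V\<close>.\<close>
  have RV: "\<forall>z\<in>D. R z \<in> V \<times> V" if V: "subspace V" and FV: "\<forall>z\<in>D. F z \<in> V \<times> V" for V
  proof
    fix z assume "z \<in> D"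
    then have "F z \<in> V \<times> V" "F w \<in> V \<times> V"
      using FV w(2) by auto
    moreover from this have "a \<in> V" "b \<in> V"
      using V by (auto simp: a b mem_Times_iff intro!: subspace_diff subspace_scale)
    ultimately show "R z \<in> V \<times> V"
      using V by (auto simp: R_def cscale_def mem_Times_iff intro!: subspace_diff subspace_scale)
  qed
  have fx: "\<forall>x\<in>slice_domain D. f x = char_poly y x * h x + x * a + b"
  proof
    fix x :: 'a assume "x \<in> slice_domain D"
    then obtain r s I where x: "x = r *\<^sub>R 1 + s *\<^sub>R I" "Complex r s \<in> D" "I \<in> imag_units"
      by (auto simp: slice_domain_def)
    let ?z = "Complex r s"
    have c: "char_poly y x = Re (p ?z) *\<^sub>R 1 + Im (p ?z) *\<^sub>R I"
      using char_poly_slice_point[OF y(2) x(3) p_def[of ?z]] by (simp add: y(1) x(1) w(1))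
    have "char_poly y x * h x = fst (R ?z) + I * snd (R ?z)"
      unfolding c unfolding x(1) is_slice_functionD[OF h(1) x(3,2)] slice_value_cscale[OF x(3)]
        bspec[OF RH x(2)] ..
    moreover have "f x = fst (F ?z) + I * snd (F ?z)"
      using is_slice_functionD[OF F(1) x(3,2)] x(1) by simp
    ultimately show "f x = char_poly y x * h x + x * a + b"
      by (simp add: R_def cscale_def x(1) alt_algebra_simps algebra_simps)
  qed
  have "\<forall>V. subspace V \<and> V \<subseteq> normal_cone \<and> (\<forall>z\<in>D. F z \<in> V \<times> V) \<longrightarrow> admissible_slice D h"
  proof (intro allI impI, elim conjE)
    fix V :: "'a set"
    assume V: "subspace V" "V \<subseteq> normal_cone" "\<forall>z\<in>D. F z \<in> V \<times> V"
    show "admissible_slice D h"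
      using spec[OF hV(1), of V] V(1,2) RV[OF V(1,3)] by simp
  qed
  moreover have "(\<forall>z\<in>D. F z \<in> real_line \<times> real_line) \<longrightarrow> real_slice D h"
    using hV(2) RV[OF subspace_real_line] by simp
  ultimately show thesis
    by (rule that[OF h(2) fx])
qed

text \<open>Two zeros \<open>\<alpha> + \<beta> I\<close> and \<open>\<alpha> + \<beta> J\<close> on one sphere give \<open>(I - J) * F\<^sub>2 = 0\<close>, where \<open>F\<^sub>2\<close> lies in the
  normal cone; so either \<open>F\<^sub>2 = 0\<close> or \<open>I = J\<close>.\<close>

lemma zeros_on_sphere_unique:
  assumes "v \<in> normal_cone" "v \<noteq> 0" "u + I * v = 0" "u + J * v = 0"
  shows "I = J"
proof -
  obtain v' where "is_inverse v v'"
    using normal_cone_inverse assms(1,2) by blast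
  moreover have "(I - J) * v = 0"
    using assms(3,4) unfolding mult_diff_left_alt by (metis add_left_cancel right_minus_eq)
  ultimately show ?thesis
    using mult_inverse_right_cancel by fastforce
qed

text \<open>On the sphere of \<open>y\<close>, \<open>f\<close> takes the values
  \<open>u + I * v\<close> with \<open>u\<close>, \<open>v\<close> the fixed components of
  \<open>F w\<close>. If \<open>v = 0\<close>, then \<open>u = 0\<close> and the whole sphere
  consists of zeros; otherwise only \<open>y\<close> remains.\<close>

lemma nonreal_zero_types:
  fixes f :: "'a::alternative_star_algebra \<Rightarrow> 'a"
  assumes F: "is_slice_function D F f"
    and y: "y = \<alpha> *\<^sub>R 1 + \<beta> *\<^sub>R J" "J \<in> imag_units" "y \<in> zero_set D f"
    and w: "w = Complex \<alpha> \<beta>" "w \<in> D" "\<beta> \<noteq> 0"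
    and N: "snd (F w) \<in> normal_cone"
  shows "fst (F w) + J * snd (F w) = 0"
    and "spherical_zero D f y \<longleftrightarrow> snd (F w) = 0"
    and "isolated_nonreal_zero D f y \<longleftrightarrow> snd (F w) \<noteq> 0"
proof -
  let ?pt = "\<lambda>I. \<alpha> *\<^sub>R 1 + \<beta> *\<^sub>R I :: 'a"
  have val: "f (?pt I) = fst (F w) + I * snd (F w)" if "I \<in> imag_units" for I
    using is_slice_functionD[OF F that, of \<alpha> \<beta>] w(1,2) by simp
  have zs: "?pt I \<in> zero_set D f \<longleftrightarrow> fst (F w) + I * snd (F w) = 0" if "I \<in> imag_units" for I
  proof -
    have "?pt I \<in> slice_domain D"
      using that w(1,2) unfolding slice_domain_def by blast
    then show ?thesis
      using val[OF that] by (simp add: zero_set_def)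
  qed
  have sph: "sphere_of y = ?pt ` imag_units"
    unfolding y(1) by (rule sphere_of_slice_point[OF y(2)])
  have nr: "y \<notin> real_line"
    using slice_point_real_iff[OF y(2)] y(1) w(3) by simp
  show 0: "fst (F w) + J * snd (F w) = 0"
    using zs[OF y(2)] y(1,3) by simp
  have all: "sphere_of y \<subseteq> zero_set D f" if "snd (F w) = 0"
  proof -
    have "fst (F w) + I * snd (F w) = 0" for I
      using that 0 by simp
    then show ?thesis
      unfolding sph using zs by blast
  qed
  \<comment> \<open>A second point of the sphere, so that a spherical zero cannot be
    isolated.\<close>
  have mJ: "?pt (- J) \<in> sphere_of y" "?pt (- J) \<noteq> y"
  proof -
    show "?pt (- J) \<in> sphere_of y"
      unfolding sph by (rule imageI[OF imag_unit_minus[OF y(2)]])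
    have "J \<noteq> 0"
      using subspace_0[OF subspace_real_line] imag_unit_not_real[OF y(2)] by blast
    have "?pt (- J) = y \<Longrightarrow> \<beta> *\<^sub>R J + \<beta> *\<^sub>R J = 0"
      unfolding y(1) by (simp add: eq_neg_iff_add_eq_0 neg_equal_iff_equal eq_commute[of "- _"])
    with \<open>J \<noteq> 0\<close> w(3) show "?pt (- J) \<noteq> y"
      by (auto simp flip: scaleR_2)
  qed
  have only: "sphere_of y \<inter> zero_set D f = {y}" if "snd (F w) \<noteq> 0"
  proof -
    have "I = J" if "I \<in> imag_units" "?pt I \<in> zero_set D f" for I
      using zeros_on_sphere_unique[OF N \<open>snd (F w) \<noteq> 0\<close> iffD1[OF zs] 0] that by blast
    moreover have "y \<in> sphere_of y"
      unfolding sph using y(1,2) by blast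
    ultimately show ?thesis
      using y(1,3) unfolding sph by blast
  qed
  show "spherical_zero D f y \<longleftrightarrow> snd (F w) = 0"
    using all only mJ nr y(3) unfolding spherical_zero_def by blast
  show "isolated_nonreal_zero D f y \<longleftrightarrow> snd (F w) \<noteq> 0"
    using all only mJ nr y(3) unfolding isolated_nonreal_zero_def by blast
qed

theorem theorem22:
  fixes D :: "complex set"
    and F :: "complex \<Rightarrow> 'a::alternative_star_algebra \<times> 'a"
    and f :: "'a \<Rightarrow> 'a"
    and y :: 'a
  assumes "DIM('a) > 1"
    and "(imag_units :: 'a set) \<noteq> {}"
    and "open D"
    and "\<forall>z\<in>D. cnj z \<in> D"
    and "is_slice_function D F f"
    and "slice_regular D f"
    and "admissible_slice D f"
    and "y \<in> zero_set D f"
  shows "(real_zero D f y \<longrightarrow>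
      (\<exists>g. slice_regular D g \<and>
        (\<forall>x\<in>slice_domain D. f x = (x - y) * g x) \<and>
        (stem_in_normal_subspace D F \<longrightarrow> admissible_slice D g) \<and>
        (real_slice D f \<longrightarrow> real_slice D g))) \<and>
    (y \<in> slice_domain D - real_line \<longrightarrow>
      (\<exists>h a b. slice_regular D h \<and>
        span {a, b} \<subseteq> normal_cone \<and>
        (\<forall>x\<in>slice_domain D. f x = char_poly y x * h x + x * a + b) \<and>
        (spherical_zero D f y \<longleftrightarrow> a = 0 \<and> b = 0) \<and>
        (isolated_nonreal_zero D f y \<longleftrightarrow> a \<noteq> 0) \<and>
        (a \<noteq> 0 \<longrightarrow> (\<exists>a'. is_inverse a a' \<and> y = - (b * a'))) \<and>
        (stem_in_normal_subspace D F \<longrightarrow> admissible_slice D h) \<and>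
        (real_slice D f \<longrightarrow> real_slice D h \<and> a = 0 \<and> b = 0)))"
proof (intro conjI impI)
  \<comment> \<open>The hypotheses on \<open>f\<close> provide separate stem functions; all are
    transferred to one holomorphic \<open>F0\<close>, with which they agree on
    \<open>D\<close>.\<close>
  obtain F0 where F0: "is_slice_function D F0 f" "holomorphic_stem D F0"
    using assms(6) unfolding slice_regular_def by blast
  have eq: "F' z = F0 z" if "is_slice_function D F' f" "z \<in> D" for F' z
    using slice_function_stem_unique[OF assms(2) that(1) F0(1) that(2)] .
  have V: "\<exists>V. subspace V \<and> V \<subseteq> normal_cone \<and> (\<forall>z\<in>D. F0 z \<in> V \<times> V)" if "stem_in_normal_subspace D F"
    using that eq[OF assms(5)] by (simp add: stem_in_normal_subspace_def)
  have real: "\<forall>z\<in>D. F0 z \<in> real_line \<times> real_line" if r: "real_slice D f"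
  proof -
    obtain F' where F': "is_slice_function D F' f" "\<forall>z\<in>D. fst (F' z) \<in> real_line \<and> snd (F' z) \<in> real_line"
      using r unfolding real_slice_def by blast
    then show ?thesis
      using eq[OF F'(1)] by (simp add: mem_Times_iff)
  qed
  have adm: "span {fst (F0 z), snd (F0 z)} \<subseteq> normal_cone" if "z \<in> D" for z
  proof -
    obtain F' where F': "is_slice_function D F' f" "\<forall>z\<in>D. span {fst (F' z), snd (F' z)} \<subseteq> normal_cone"
      using assms(7) unfolding admissible_slice_def by blast
    then show ?thesis
      using eq[OF F'(1) that] that by metis
  qed
  show "\<exists>g. slice_regular D g \<and>
      (\<forall>x\<in>slice_domain D. f x = (x - y) * g x) \<and>
      (stem_in_normal_subspace D F \<longrightarrow> admissible_slice D g) \<and>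
      (real_slice D f \<longrightarrow> real_slice D g)" if z: "real_zero D f y"
  proof -
    obtain g where g: "slice_regular D g" "\<forall>x\<in>slice_domain D. f x = (x - y) * g x"
      and "\<forall>V. subspace V \<and> V \<subseteq> normal_cone \<and> (\<forall>z\<in>D. F0 z \<in> V \<times> V) \<longrightarrow> admissible_slice D g"
        "(\<forall>z\<in>D. F0 z \<in> real_line \<times> real_line) \<longrightarrow> real_slice D g"
      using real_zero_factorization[OF assms(3,4) F0 z] .
    with V real show ?thesis by blast
  qed
  assume "y \<in> slice_domain D - real_line"
  then obtain \<alpha> \<beta> J where y: "y = \<alpha> *\<^sub>R 1 + \<beta> *\<^sub>R J" "J \<in> imag_units" and D: "Complex \<alpha> \<beta> \<in> D"
    and "y \<notin> real_line"
    unfolding slice_domain_def by blast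
  then have \<beta>: "\<beta> \<noteq> 0"
    using slice_point_real_iff by blast
  define w where "w = Complex \<alpha> \<beta>"
  define a where "a = inverse \<beta> *\<^sub>R snd (F0 w)"
  define b where "b = fst (F0 w) - \<alpha> *\<^sub>R a"
  have w: "w \<in> D"
    using D by (simp add: w_def)
  \<comment> \<open>Both coefficients lie in the span of the components at \<open>w\<close>, which
    admissibility places in the normal cone.\<close>
  have a_span: "a \<in> span {fst (F0 w), snd (F0 w)}"
    unfolding a_def by (intro span_scale span_base) simp
  have "b \<in> span {fst (F0 w), snd (F0 w)}"
    unfolding b_def by (intro span_diff span_scale a_span span_base) simp
  with a_span have "span {a, b} \<subseteq> span {fst (F0 w), snd (F0 w)}"
    by (intro span_minimal) auto
  with adm[OF w] have span: "span {a, b} \<subseteq> normal_cone"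
    by blast
  have "snd (F0 w) \<in> normal_cone"
    using adm[OF w] by (auto intro: span_base)
  note types = nonreal_zero_types[OF F0(1) y assms(8) w_def w \<beta> this]
  have a0: "a = 0 \<longleftrightarrow> snd (F0 w) = 0"
    using \<beta> by (simp add: a_def)
  have b0: "b = 0" if "a = 0"
    using types(1) that a0 by (simp add: b_def)
  \<comment> \<open>Interpolation is exact at \<open>w\<close>, so \<open>y * a + b\<close> is the
    value of \<open>f\<close> at its zero \<open>y\<close>.\<close>
  have ya: "y * a = - b"
  proof -
    have "y * a + b = fst (F0 w) + J * snd (F0 w)"
      using \<beta> by (simp add: y(1) b_def a_def alt_algebra_simps scaleR_add_right mult.commute)
    then show ?thesis
      using types(1) by (simp add: add_eq_0_iff)
  qed
  have inv: "\<exists>a'. is_inverse a a' \<and> y = - (b * a')" if nz: "a \<noteq> 0"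
  proof -
    have "a \<in> normal_cone"
      using span by (auto intro: span_base)
    then obtain a' where a': "is_inverse a a'"
      using nz by (rule normal_cone_inverse)
    \<comment> \<open>Multiplying \<open>y * a = - b\<close> on the right by \<open>a'\<close>
      returns \<open>y\<close>, a consequence of the Moufang identity.\<close>
    then have "y = - (b * a')"
      using mult_inverse_right[OF a', of y] by (simp add: ya mult_minus_left_alt)
    with a' show ?thesis by blast
  qed
  have real0: "a = 0" if "real_slice D f"
  proof (rule ccontr)
    assume "a \<noteq> 0"
    have "fst (F0 w) \<in> real_line" "snd (F0 w) \<in> real_line"
      using bspec[OF real[OF that] w] by (simp_all add: mem_Times_iff)
    then obtain r s where rs: "fst (F0 w) = r *\<^sub>R 1" "snd (F0 w) = s *\<^sub>R 1"
      unfolding real_line_def by blast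
    \<comment> \<open>With real components this element is the value of \<open>f\<close> at
      \<open>y\<close>, namely \<open>0\<close>; being real, it has imaginary coefficient
      \<open>s = 0\<close>, against \<open>a \<noteq> 0\<close>.\<close>
    then have "r *\<^sub>R 1 + s *\<^sub>R J \<in> real_line"
      using types(1) subspace_0[OF subspace_real_line] by (simp add: alt_algebra_simps)
    then show False
      using slice_point_real_iff[OF y(2)] \<open>a \<noteq> 0\<close> rs a0 by simp
  qed
  obtain h where h: "slice_regular D h" "\<forall>x\<in>slice_domain D. f x = char_poly y x * h x + x * a + b"
    and hV: "\<forall>V. subspace V \<and> V \<subseteq> normal_cone \<and> (\<forall>z\<in>D. F0 z \<in> V \<times> V) \<longrightarrow> admissible_slice D h"
      "(\<forall>z\<in>D. F0 z \<in> real_line \<times> real_line) \<longrightarrow> real_slice D h"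
    using nonreal_factorization[OF assms(3,4) F0 y w_def w \<beta> a_def b_def] .
  show "\<exists>h a b. slice_regular D h \<and>
      span {a, b} \<subseteq> normal_cone \<and>
      (\<forall>x\<in>slice_domain D. f x = char_poly y x * h x + x * a + b) \<and>
      (spherical_zero D f y \<longleftrightarrow> a = 0 \<and> b = 0) \<and>
      (isolated_nonreal_zero D f y \<longleftrightarrow> a \<noteq> 0) \<and>
      (a \<noteq> 0 \<longrightarrow> (\<exists>a'. is_inverse a a' \<and> y = - (b * a'))) \<and>
      (stem_in_normal_subspace D F \<longrightarrow> admissible_slice D h) \<and>
      (real_slice D f \<longrightarrow> real_slice D h \<and> a = 0 \<and> b = 0)"
  proof (intro exI conjI)
    show "spherical_zero D f y \<longleftrightarrow> a = 0 \<and> b = 0"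
      using types(2) a0 b0 by blast
    show "isolated_nonreal_zero D f y \<longleftrightarrow> a \<noteq> 0"
      using types(3) a0 by blast
    show "stem_in_normal_subspace D F \<longrightarrow> admissible_slice D h"
      using V hV(1) by blast
    show "real_slice D f \<longrightarrow> real_slice D h \<and> a = 0 \<and> b = 0"
      using real hV(2) real0 b0 by blast
  qed (use h span inv in auto)
qed

end
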